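(* Let $N\ge 2$, let $\mathcal H$ be an $N$-dimensional complex Hilbert space with fixed orthonormal basis $\{|\mu\rangle\}_{\mu=0}^{N-1}$, let $\epsilon\in[0,1]$, $\gamma\in\mathbb C$, $\alpha_{\mu\nu}\in\mathbb C$, and suppose that the map $$\Lambda_{\epsilon,\gamma}(\rho)=\sum_{\mu=0}^{N-1}\rho_{\mu\mu}\Big[(1-\epsilon)|\mu\rangle\langle\mu|+\sum_{\nu\ne\mu}\frac{\epsilon}{N-1}|\nu\rangle\langle\nu|\Big]+\sum_{\mu<\nu}\Big\{\rho_{\mu\nu}\big[(1+\alpha_{\mu\nu})|\mu\rangle\langle\nu|+\gamma|\nu\rangle\langle\mu|\big]+\mathrm{h.c.}\Big\}$$ is completely positive and trace-preserving (i.e. is a faulty $(\epsilon,\gamma)$-aQNN). Then $\Lambda_{\epsilon,\gamma}$ is a strictly incoherent operation (SIO) with respect to the basis $\{|\mu\rangle\}$.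
   Context: $\rho_{\mu\nu}=\langle\mu|\rho|\nu\rangle$, and h.c. denotes the Hermitian conjugate for Hermitian $\rho$ (the map is then extended linearly). The set $\mathbb I$ of incoherent states consists of the density operators diagonal in the basis $\{|\mu\rangle\}$. A completely positive trace-preserving map $\mathcal E$ is a strictly incoherent operation (SIO) if it has a Kraus representation $\mathcal E(\cdot)=\sum_aK_a\cdot K_a^\dagger$ such that for every $a$ and every $\delta\in\mathbb I$ both $K_a\delta K_a^\dagger$ and $K_a^\dagger\delta K_a$ are diagonal in the basis (incoherent up to normalization). *)

theory Defs
  imports "Jordan_Normal_Form.Matrix" "Jordan_Normal_Form.Schur_Decomposition"
begin

text \<open>
  The Hilbert space of dimension \<open>N\<close> is the coordinate space of complex vectors of length \<open>N\<close>,
  the fixed orthonormal basis is the standard one, and operators are their \<open>N \<times> N\<close> matrices;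
  \<^term>\<open>A $$ (\<mu>, \<nu>)\<close> is the matrix element of \<open>A\<close> between basis vectors \<open>\<mu>\<close> (bra) and \<open>\<nu>\<close> (ket).
\<close>

definition ketbra :: "nat \<Rightarrow> nat \<Rightarrow> nat \<Rightarrow> complex mat" where
  "ketbra N \<mu> \<nu> = mat N N (\<lambda>(i, j). if i = \<mu> \<and> j = \<nu> then 1 else 0)"

text \<open>
  Matrices of all sizes share one type, which therefore has no zero and is not an instance of
  \<^class>\<open>comm_monoid_add\<close>; finite sums of \<open>N \<times> N\<close> matrices are taken entrywise.
\<close>

definition msum :: "nat \<Rightarrow> ('i \<Rightarrow> complex mat) \<Rightarrow> 'i set \<Rightarrow> complex mat" where
  "msum N f I = mat N N (\<lambda>(i, j). \<Sum>a\<in>I. f a $$ (i, j))"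

definition mat_trace :: "complex mat \<Rightarrow> complex" where
  "mat_trace A = (\<Sum>i<dim_row A. A $$ (i, i))"

definition hermitian_mat :: "complex mat \<Rightarrow> bool" where
  "hermitian_mat A \<longleftrightarrow> mat_adjoint A = A"

text \<open>
  In the order on \<^typ>\<open>complex\<close>, \<open>0 \<le> z\<close> says that \<open>z\<close> is real and nonnegative.
\<close>

definition psd_mat :: "nat \<Rightarrow> complex mat \<Rightarrow> bool" where
  "psd_mat n A \<longleftrightarrow> A \<in> carrier_mat n n \<and> (\<forall>v\<in>carrier_vec n. 0 \<le> (A *\<^sub>v v) \<bullet>c v)"

definition density_operators :: "nat \<Rightarrow> complex mat set" where
  "density_operators N = {\<rho>. psd_mat N \<rho> \<and> mat_trace \<rho> = 1}"

definition incoherent_states :: "nat \<Rightarrow> complex mat set" where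
  "incoherent_states N = {\<delta> \<in> density_operators N. diagonal_mat \<delta>}"

definition linear_superop :: "nat \<Rightarrow> (complex mat \<Rightarrow> complex mat) \<Rightarrow> bool" where
  "linear_superop N E \<longleftrightarrow>
     (\<forall>A\<in>carrier_mat N N. E A \<in> carrier_mat N N) \<and>
     (\<forall>A\<in>carrier_mat N N. \<forall>B\<in>carrier_mat N N. E (A + B) = E A + E B) \<and>
     (\<forall>A\<in>carrier_mat N N. \<forall>c. E (c \<cdot>\<^sub>m A) = c \<cdot>\<^sub>m E A)"

text \<open>
  A \<open>kN \<times> kN\<close> matrix is read as a \<open>k \<times> k\<close> array of \<open>N \<times> N\<close> blocks.
\<close>

definition mat_block :: "nat \<Rightarrow> complex mat \<Rightarrow> nat \<Rightarrow> nat \<Rightarrow> complex mat" where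
  "mat_block N X a b = mat N N (\<lambda>(i, j). X $$ (a * N + i, b * N + j))"

text \<open>
  The superoperator \<open>id\<^sub>k \<otimes> E\<close> applies \<open>E\<close> to every block.
\<close>

definition ampliation ::
  "nat \<Rightarrow> nat \<Rightarrow> (complex mat \<Rightarrow> complex mat) \<Rightarrow> complex mat \<Rightarrow> complex mat" where
  "ampliation N k E X =
     mat (k * N) (k * N) (\<lambda>(p, q). E (mat_block N X (p div N) (q div N)) $$ (p mod N, q mod N))"

definition completely_positive :: "nat \<Rightarrow> (complex mat \<Rightarrow> complex mat) \<Rightarrow> bool" where
  "completely_positive N E \<longleftrightarrow>
     linear_superop N E \<and>
     (\<forall>k X. psd_mat (k * N) X \<longrightarrow> psd_mat (k * N) (ampliation N k E X))"

definition trace_preserving :: "nat \<Rightarrow> (complex mat \<Rightarrow> complex mat) \<Rightarrow> bool" where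
  "trace_preserving N E \<longleftrightarrow> (\<forall>A\<in>carrier_mat N N. mat_trace (E A) = mat_trace A)"

definition cptp :: "nat \<Rightarrow> (complex mat \<Rightarrow> complex mat) \<Rightarrow> bool" where
  "cptp N E \<longleftrightarrow> completely_positive N E \<and> trace_preserving N E"

definition kraus_representation ::
  "nat \<Rightarrow> (complex mat \<Rightarrow> complex mat) \<Rightarrow> nat \<Rightarrow> (nat \<Rightarrow> complex mat) \<Rightarrow> bool" where
  "kraus_representation N E r K \<longleftrightarrow>
     (\<forall>a<r. K a \<in> carrier_mat N N) \<and>
     (\<forall>\<rho>\<in>carrier_mat N N. E \<rho> = msum N (\<lambda>a. K a * \<rho> * mat_adjoint (K a)) {..<r})"

definition strictly_incoherent_operation :: "nat \<Rightarrow> (complex mat \<Rightarrow> complex mat) \<Rightarrow> bool" where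
  "strictly_incoherent_operation N E \<longleftrightarrow>
     cptp N E \<and>
     (\<exists>r K. kraus_representation N E r K \<and>
        (\<forall>a<r. \<forall>\<delta>\<in>incoherent_states N.
            diagonal_mat (K a * \<delta> * mat_adjoint (K a)) \<and>
            diagonal_mat (mat_adjoint (K a) * \<delta> * K a)))"

text \<open>
  The defining formula, whose \<open>h.c.\<close> terms give the intended (complex-linear) map only for
  Hermitian arguments; \<open>aqnn_map\<close> below is its complex-linear extension.
\<close>

definition aqnn_hermitian ::
  "nat \<Rightarrow> real \<Rightarrow> complex \<Rightarrow> (nat \<Rightarrow> nat \<Rightarrow> complex) \<Rightarrow> complex mat \<Rightarrow> complex mat" where
  "aqnn_hermitian N \<epsilon> \<gamma> \<alpha> \<rho> =
     msum N (\<lambda>\<mu>. \<rho> $$ (\<mu>, \<mu>) \<cdot>\<^sub>m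
         (complex_of_real (1 - \<epsilon>) \<cdot>\<^sub>m ketbra N \<mu> \<mu> +
          msum N (\<lambda>\<nu>. complex_of_real (\<epsilon> / (real N - 1)) \<cdot>\<^sub>m ketbra N \<nu> \<nu>) ({..<N} - {\<mu>})))
       {..<N} +
     msum N (\<lambda>(\<mu>, \<nu>).
         let X = \<rho> $$ (\<mu>, \<nu>) \<cdot>\<^sub>m ((1 + \<alpha> \<mu> \<nu>) \<cdot>\<^sub>m ketbra N \<mu> \<nu> + \<gamma> \<cdot>\<^sub>m ketbra N \<nu> \<mu>)
         in X + mat_adjoint X)
       {(\<mu>, \<nu>). \<mu> < \<nu> \<and> \<nu> < N}"

text \<open>
  The Cartesian decomposition \<open>A = Re A + i Im A\<close> into Hermitian matrices.
\<close>

definition mat_Re :: "complex mat \<Rightarrow> complex mat" where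
  "mat_Re A = (1 / 2) \<cdot>\<^sub>m (A + mat_adjoint A)"

definition mat_Im :: "complex mat \<Rightarrow> complex mat" where
  "mat_Im A = (1 / (2 * \<i>)) \<cdot>\<^sub>m (A - mat_adjoint A)"

definition aqnn_map ::
  "nat \<Rightarrow> real \<Rightarrow> complex \<Rightarrow> (nat \<Rightarrow> nat \<Rightarrow> complex) \<Rightarrow> complex mat \<Rightarrow> complex mat" where
  "aqnn_map N \<epsilon> \<gamma> \<alpha> A =
     aqnn_hermitian N \<epsilon> \<gamma> \<alpha> (mat_Re A) + \<i> \<cdot>\<^sub>m aqnn_hermitian N \<epsilon> \<gamma> \<alpha> (mat_Im A)"

lemma mat_adjoint_dim [simp]:
  "dim_row (mat_adjoint A) = dim_col A" "dim_col (mat_adjoint A) = dim_row A"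
  by (simp_all add: mat_adjoint_def)

lemma mat_adjoint_index [simp]:
  "i < dim_col A \<Longrightarrow> j < dim_row A \<Longrightarrow> mat_adjoint A $$ (i, j) = conjugate (A $$ (j, i))"
  by (simp add: mat_adjoint_def mat_of_rows_index)

lemma ketbra_dim [simp]: "dim_row (ketbra N \<mu> \<nu>) = N" "dim_col (ketbra N \<mu> \<nu>) = N"
  by (simp_all add: ketbra_def)

lemma msum_dim [simp]: "dim_row (msum N f I) = N" "dim_col (msum N f I) = N"
  by (simp_all add: msum_def)

lemma msum_index [simp]:
  "i < N \<Longrightarrow> j < N \<Longrightarrow> msum N f I $$ (i, j) = (\<Sum>a\<in>I. f a $$ (i, j))"
  by (simp add: msum_def)

lemma aqnn_hermitian_carrier: "aqnn_hermitian N \<epsilon> \<gamma> \<alpha> \<rho> \<in> carrier_mat N N"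
  by (simp add: aqnn_hermitian_def msum_def)

lemma mat_Re_hermitian: "A \<in> carrier_mat N N \<Longrightarrow> hermitian_mat (mat_Re A)"
  unfolding hermitian_mat_def by (rule eq_matI) (auto simp: mat_Re_def)

lemma mat_Im_hermitian: "A \<in> carrier_mat N N \<Longrightarrow> hermitian_mat (mat_Im A)"
  unfolding hermitian_mat_def by (rule eq_matI) (auto simp: mat_Im_def field_simps)

lemma mat_Re_Im: "A \<in> carrier_mat N N \<Longrightarrow> mat_Re A + \<i> \<cdot>\<^sub>m mat_Im A = A"
  by (rule eq_matI) (auto simp: mat_Re_def mat_Im_def field_simps)

lemma aqnn_map_hermitian:
  assumes A: "A \<in> carrier_mat N N" and h: "hermitian_mat A"
  shows "aqnn_map N \<epsilon> \<gamma> \<alpha> A = aqnn_hermitian N \<epsilon> \<gamma> \<alpha> A"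
proof -
  have re: "mat_Re A = A" using A h
    by (intro eq_matI) (auto simp: mat_Re_def hermitian_mat_def)
  have im: "mat_Im A = 0\<^sub>m N N" using A h
    by (intro eq_matI) (auto simp: mat_Im_def hermitian_mat_def)
  have z: "aqnn_hermitian N \<epsilon> \<gamma> \<alpha> (0\<^sub>m N N) = 0\<^sub>m N N"
    by (rule eq_matI)
       (auto simp: aqnn_hermitian_def msum_def ketbra_def Let_def intro!: sum.neutral)
  show ?thesis using aqnn_hermitian_carrier[of N \<epsilon> \<gamma> \<alpha> A] 
    by (auto simp: aqnn_map_def re im z intro!: eq_matI)
qed

lemma aqnn_map_linear: "linear_superop N (aqnn_map N \<epsilon> \<gamma> \<alpha>)"
proof -
  define D where "D = (\<lambda>i j \<mu>. complex_of_real (1 - \<epsilon>) * ketbra N \<mu> \<mu> $$ (i, j) +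
        (\<Sum>\<nu>\<in>{..<N} - {\<mu>}. complex_of_real (\<epsilon> / (real N - 1)) * ketbra N \<nu> \<nu> $$ (i, j)))"
  define C where "C = (\<lambda>i j p. (1 + \<alpha> (fst p) (snd p)) * ketbra N (fst p) (snd p) $$ (i, j)
                  + \<gamma> * ketbra N (snd p) (fst p) $$ (i, j))"
  let ?P = "{(\<mu>, \<nu>). \<mu> < \<nu> \<and> \<nu> < N}"
  have herm: "aqnn_hermitian N \<epsilon> \<gamma> \<alpha> X $$ (i, j) =
     (\<Sum>\<mu><N. X $$ (\<mu>, \<mu>) * D i j \<mu>) +
     (\<Sum>p\<in>?P. X $$ p * C i j p + cnj (X $$ p) * cnj (C j i p))"
    if "i < N" "j < N" for X i j
    using that by (simp add: aqnn_hermitian_def D_def C_def Let_def case_prod_beta)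
  have ri: "mat_Re A $$ p + \<i> * mat_Im A $$ p = A $$ p"
      "cnj (mat_Re A $$ p) + \<i> * cnj (mat_Im A $$ p) = A $$ (snd p, fst p)"
    if "A \<in> carrier_mat N N" "fst p < N" "snd p < N" for A p
    using that by (cases p; auto simp: mat_Re_def mat_Im_def field_simps)+
  have entry: "aqnn_map N \<epsilon> \<gamma> \<alpha> A $$ (i, j) =
     (\<Sum>\<mu><N. A $$ (\<mu>, \<mu>) * D i j \<mu>) +
     (\<Sum>p\<in>?P. A $$ p * C i j p + A $$ (snd p, fst p) * cnj (C j i p))"
    if A: "A \<in> carrier_mat N N" and ij: "i < N" "j < N" for A i j
  proof -
    have "aqnn_map N \<epsilon> \<gamma> \<alpha> A $$ (i, j) =
      (\<Sum>\<mu><N. (mat_Re A $$ (\<mu>, \<mu>) + \<i> * mat_Im A $$ (\<mu>, \<mu>)) * D i j \<mu>) +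
      (\<Sum>p\<in>?P. (mat_Re A $$ p + \<i> * mat_Im A $$ p) * C i j p +
         (cnj (mat_Re A $$ p) + \<i> * cnj (mat_Im A $$ p)) * cnj (C j i p))"
      using aqnn_hermitian_carrier[of N \<epsilon> \<gamma> \<alpha> "mat_Re A"]
        aqnn_hermitian_carrier[of N \<epsilon> \<gamma> \<alpha> "mat_Im A"] ij
      by (simp add: aqnn_map_def herm[OF ij])
         (simp add: algebra_simps sum.distrib sum_distrib_left)
    also have "\<dots> = (\<Sum>\<mu><N. A $$ (\<mu>, \<mu>) * D i j \<mu>) +
      (\<Sum>p\<in>?P. A $$ p * C i j p + A $$ (snd p, fst p) * cnj (C j i p))"
      by (intro arg_cong2[where f = "(+)"] sum.cong refl) (auto simp: ri[OF A])
    finally show ?thesis .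
  qed
  have carr: "aqnn_map N \<epsilon> \<gamma> \<alpha> A \<in> carrier_mat N N" for A
    using aqnn_hermitian_carrier by (auto simp: aqnn_map_def)
  have add: "aqnn_map N \<epsilon> \<gamma> \<alpha> (A + B) = aqnn_map N \<epsilon> \<gamma> \<alpha> A + aqnn_map N \<epsilon> \<gamma> \<alpha> B"
    if "A \<in> carrier_mat N N" "B \<in> carrier_mat N N" for A B
  proof (rule eq_matI, goal_cases)
    case (1 i j)
    then have ij: "i < N" "j < N" using carr[of B] by auto
    have s1: "(\<Sum>\<mu><N. (A + B) $$ (\<mu>, \<mu>) * D i j \<mu>) =
        (\<Sum>\<mu><N. A $$ (\<mu>, \<mu>) * D i j \<mu>) + (\<Sum>\<mu><N. B $$ (\<mu>, \<mu>) * D i j \<mu>)"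
      unfolding sum.distrib[symmetric] using that by (intro sum.cong) (auto simp: algebra_simps)
    have s2: "(\<Sum>p\<in>?P. (A + B) $$ p * C i j p + (A + B) $$ (snd p, fst p) * cnj (C j i p)) =
        (\<Sum>p\<in>?P. A $$ p * C i j p + A $$ (snd p, fst p) * cnj (C j i p)) +
        (\<Sum>p\<in>?P. B $$ p * C i j p + B $$ (snd p, fst p) * cnj (C j i p))"
      unfolding sum.distrib[symmetric] using that by (intro sum.cong) (auto simp: algebra_simps)
    have AB: "A + B \<in> carrier_mat N N" using that by simp
    have "aqnn_map N \<epsilon> \<gamma> \<alpha> (A + B) $$ (i, j) =
        aqnn_map N \<epsilon> \<gamma> \<alpha> A $$ (i, j) + aqnn_map N \<epsilon> \<gamma> \<alpha> B $$ (i, j)"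
      unfolding entry[OF AB ij] entry[OF that(1) ij] entry[OF that(2) ij] s1 s2 by simp
    then show ?case using ij carr[of A] carr[of B] by simp
  next
    case 2 then show ?case using carr[of B] carr[of "A + B"] by auto
  next
    case 3 then show ?case using carr[of B] carr[of "A + B"] by auto
  qed
  have scale: "aqnn_map N \<epsilon> \<gamma> \<alpha> (c \<cdot>\<^sub>m A) = c \<cdot>\<^sub>m aqnn_map N \<epsilon> \<gamma> \<alpha> A"
    if "A \<in> carrier_mat N N" for A c
  proof (rule eq_matI, goal_cases)
    case (1 i j)
    then have ij: "i < N" "j < N" using carr[of A] by auto
    have s1: "(\<Sum>\<mu><N. (c \<cdot>\<^sub>m A) $$ (\<mu>, \<mu>) * D i j \<mu>) = c * (\<Sum>\<mu><N. A $$ (\<mu>, \<mu>) * D i j \<mu>)"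
      using that by (auto simp: sum_distrib_left intro!: sum.cong)
    have s2: "(\<Sum>p\<in>?P. (c \<cdot>\<^sub>m A) $$ p * C i j p + (c \<cdot>\<^sub>m A) $$ (snd p, fst p) * cnj (C j i p)) =
        c * (\<Sum>p\<in>?P. A $$ p * C i j p + A $$ (snd p, fst p) * cnj (C j i p))"
      unfolding sum_distrib_left using that by (intro sum.cong) (auto simp: algebra_simps)
    have "aqnn_map N \<epsilon> \<gamma> \<alpha> (c \<cdot>\<^sub>m A) $$ (i, j) = c * aqnn_map N \<epsilon> \<gamma> \<alpha> A $$ (i, j)"
      unfolding entry[OF smult_carrier_mat[OF that] ij] entry[OF that ij] s1 s2
      by (simp add: distrib_left)
    then show ?case using ij carr[of A] by simp
  next
    case 2 then show ?case using carr[of A] carr[of "c \<cdot>\<^sub>m A"] by auto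
  next
    case 3 then show ?case using carr[of A] carr[of "c \<cdot>\<^sub>m A"] by auto
  qed
  show ?thesis using carr add scale by (auto simp: linear_superop_def)
qed

end

theory Submission
  imports Defs "HOL-Combinatorics.Transposition"
begin

text \<open>
  The Choi matrix of the map splits into the block spanned by the vectors \<open>|\<mu>\<mu>\<rangle>\<close> and, for every pair
  \<open>\<mu> < \<nu>\<close>, a \<open>2 \<times> 2\<close> block on \<open>|\<mu>\<nu>\<rangle>, |\<nu>\<mu>\<rangle>\<close> with diagonal entries \<open>p = \<epsilon> / (N - 1)\<close> and
  off-diagonal entries \<open>\<gamma>\<close> and its conjugate. Complete positivity makes each block positive, and a
  factorisation into rank-one terms gives diagonal Kraus operators from the first block and Kraus
  operators supported on the positions \<open>(\<mu>, \<nu>), (\<nu>, \<mu>)\<close> from the others. All of them are a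
  diagonal matrix times the permutation matrix of an involution, hence map diagonal matrices to
  diagonal matrices, and so do their adjoints.
\<close>

section \<open>Matrix entries of the map and of its linear extension\<close>

lemma aqnn_hermitian_index_diag:
  assumes "i < N"
  shows "aqnn_hermitian N \<epsilon> \<gamma> \<alpha> X $$ (i, i) =
    complex_of_real (1 - \<epsilon>) * X $$ (i, i) +
    (\<Sum>\<nu>\<in>{..<N} - {i}. complex_of_real (\<epsilon> / (real N - 1)) * X $$ (\<nu>, \<nu>))"
proof -
  let ?p = "complex_of_real (\<epsilon> / (real N - 1))"
  let ?P = "{(\<mu>, \<nu>). \<mu> < \<nu> \<and> \<nu> < N}"
  have inner: "(\<Sum>\<nu>\<in>{..<N} - {\<mu>}. ?p * ketbra N \<nu> \<nu> $$ (i, i)) = (if \<mu> = i then 0 else ?p)"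
    for \<mu>
  proof -
    have "(\<Sum>\<nu>\<in>{..<N} - {\<mu>}. ?p * ketbra N \<nu> \<nu> $$ (i, i)) =
        (\<Sum>\<nu>\<in>{..<N} - {\<mu>}. if \<nu> = i then ?p else 0)"
      using assms by (intro sum.cong) (auto simp: ketbra_def)
    then show ?thesis using assms by simp
  qed
  have "aqnn_hermitian N \<epsilon> \<gamma> \<alpha> X $$ (i, i) =
      (\<Sum>\<mu><N. X $$ (\<mu>, \<mu>) * (complex_of_real (1 - \<epsilon>) * ketbra N \<mu> \<mu> $$ (i, i) +
        (if \<mu> = i then 0 else ?p)))"
  proof -
    have "(\<Sum>p\<in>?P. X $$ p * ((1 + \<alpha> (fst p) (snd p)) * ketbra N (fst p) (snd p) $$ (i, i) +
        \<gamma> * ketbra N (snd p) (fst p) $$ (i, i)) +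
        cnj (X $$ p) * cnj ((1 + \<alpha> (fst p) (snd p)) * ketbra N (fst p) (snd p) $$ (i, i) +
        \<gamma> * ketbra N (snd p) (fst p) $$ (i, i))) = 0"
      using assms by (intro sum.neutral) (auto simp: ketbra_def)
    then show ?thesis
      using assms by (simp add: aqnn_hermitian_def Let_def case_prod_beta inner[simplified])
  qed
  also have "\<dots> = complex_of_real (1 - \<epsilon>) * X $$ (i, i) +
      (\<Sum>\<nu>\<in>{..<N} - {i}. ?p * X $$ (\<nu>, \<nu>))"
    using assms
    by (subst sum.remove[of _ i]) (auto simp: ketbra_def algebra_simps intro!: sum.cong)
  finally show ?thesis .
qed

text \<open>Only the unordered pair of \<open>i\<close> and \<open>j\<close> contributes, stored in
  \<open>q\<close> with the smaller index first. The conjugated terms come from the h.c. half of the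
  formula.\<close>

lemma aqnn_hermitian_index_offdiag:
  assumes "i < N" "j < N" "i \<noteq> j"
  shows "aqnn_hermitian N \<epsilon> \<gamma> \<alpha> X $$ (i, j) =
    (if i < j then (1 + \<alpha> i j) * X $$ (i, j) + cnj \<gamma> * cnj (X $$ (i, j))
     else \<gamma> * X $$ (j, i) + cnj (1 + \<alpha> j i) * cnj (X $$ (j, i)))"
proof -
  let ?P = "{(\<mu>, \<nu>). \<mu> < \<nu> \<and> \<nu> < N}"
  define q where "q = (min i j, max i j)"
  define f where "f = (\<lambda>p. X $$ p * ((1 + \<alpha> (fst p) (snd p)) * ketbra N (fst p) (snd p) $$ (i, j) +
      \<gamma> * ketbra N (snd p) (fst p) $$ (i, j)) +
      cnj (X $$ p) * cnj ((1 + \<alpha> (fst p) (snd p)) * ketbra N (fst p) (snd p) $$ (j, i) +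
      \<gamma> * ketbra N (snd p) (fst p) $$ (j, i)))"
  have fin: "finite ?P"
    by (rule finite_subset[of _ "{..<N} \<times> {..<N}"]) auto
  have "(\<Sum>\<mu><N. X $$ (\<mu>, \<mu>) * (complex_of_real (1 - \<epsilon>) * ketbra N \<mu> \<mu> $$ (i, j) +
      (\<Sum>\<nu>\<in>{..<N} - {\<mu>}. complex_of_real (\<epsilon> / (real N - 1)) * ketbra N \<nu> \<nu> $$ (i, j)))) = 0"
    using assms by (auto simp: ketbra_def intro!: sum.neutral)
  then have "aqnn_hermitian N \<epsilon> \<gamma> \<alpha> X $$ (i, j) = sum f ?P"
    using assms by (simp add: aqnn_hermitian_def Let_def case_prod_beta f_def)
  also have "\<dots> = sum f {q}"
    using assms fin by (intro sum.mono_neutral_right) (auto simp: q_def f_def ketbra_def)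
  also have "\<dots> = (if i < j then (1 + \<alpha> i j) * X $$ (i, j) + cnj \<gamma> * cnj (X $$ (i, j))
     else \<gamma> * X $$ (j, i) + cnj (1 + \<alpha> j i) * cnj (X $$ (j, i)))"
    using assms by (auto simp: q_def f_def ketbra_def)
  finally show ?thesis .
qed

text \<open>Both Cartesian parts are Hermitian, so conjugating their entries transposes them. The
  second equation thereby turns the h.c. terms into complex-linear ones.\<close>

lemma mat_Re_Im_index:
  assumes "A \<in> carrier_mat N N" "i < N" "j < N"
  shows "mat_Re A $$ (i, j) + \<i> * mat_Im A $$ (i, j) = A $$ (i, j)"
    and "cnj (mat_Re A $$ (i, j)) + \<i> * cnj (mat_Im A $$ (i, j)) = A $$ (j, i)"
  using assms by (auto simp: mat_Re_def mat_Im_def field_simps)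

lemma aqnn_map_carrier: "aqnn_map N \<epsilon> \<gamma> \<alpha> A \<in> carrier_mat N N"
  using aqnn_hermitian_carrier by (auto simp: aqnn_map_def)

lemma aqnn_map_index_diag:
  assumes A: "A \<in> carrier_mat N N" and i: "i < N"
  shows "aqnn_map N \<epsilon> \<gamma> \<alpha> A $$ (i, i) =
    complex_of_real (1 - \<epsilon>) * A $$ (i, i) +
    (\<Sum>\<nu>\<in>{..<N} - {i}. complex_of_real (\<epsilon> / (real N - 1)) * A $$ (\<nu>, \<nu>))"
proof -
  let ?p = "complex_of_real (\<epsilon> / (real N - 1))"
  have "aqnn_map N \<epsilon> \<gamma> \<alpha> A $$ (i, i) =
      complex_of_real (1 - \<epsilon>) * (mat_Re A $$ (i, i) + \<i> * mat_Im A $$ (i, i)) +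
      (\<Sum>\<nu>\<in>{..<N} - {i}. ?p * (mat_Re A $$ (\<nu>, \<nu>) + \<i> * mat_Im A $$ (\<nu>, \<nu>)))"
    using i aqnn_hermitian_carrier[of N \<epsilon> \<gamma> \<alpha> "mat_Re A"] aqnn_hermitian_carrier[of N \<epsilon> \<gamma> \<alpha> "mat_Im A"]
    by (simp add: aqnn_map_def aqnn_hermitian_index_diag)
       (simp add: distrib_left sum.distrib sum_distrib_left mult.left_commute add_ac add_divide_distrib)
  then show ?thesis using A i by (simp add: mat_Re_Im_index)
qed

lemma aqnn_map_index_offdiag:
  assumes A: "A \<in> carrier_mat N N" and ij: "i < N" "j < N" "i \<noteq> j"
  shows "aqnn_map N \<epsilon> \<gamma> \<alpha> A $$ (i, j) =
    (if i < j then 1 + \<alpha> i j else cnj (1 + \<alpha> j i)) * A $$ (i, j) +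
    (if i < j then cnj \<gamma> else \<gamma>) * A $$ (j, i)"
proof -
  note c = aqnn_hermitian_carrier[of N \<epsilon> \<gamma> \<alpha> "mat_Re A"] aqnn_hermitian_carrier[of N \<epsilon> \<gamma> \<alpha> "mat_Im A"]
  have "aqnn_map N \<epsilon> \<gamma> \<alpha> A $$ (i, j) =
    (if i < j then (1 + \<alpha> i j) * (mat_Re A $$ (i, j) + \<i> * mat_Im A $$ (i, j)) +
        cnj \<gamma> * (cnj (mat_Re A $$ (i, j)) + \<i> * cnj (mat_Im A $$ (i, j)))
     else \<gamma> * (mat_Re A $$ (j, i) + \<i> * mat_Im A $$ (j, i)) +
        cnj (1 + \<alpha> j i) * (cnj (mat_Re A $$ (j, i)) + \<i> * cnj (mat_Im A $$ (j, i))))"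
    using ij c
    by (simp add: aqnn_map_def aqnn_hermitian_index_offdiag algebra_simps)
  then show ?thesis using A ij by (simp add: mat_Re_Im_index)
qed

section \<open>Sums over index pairs and positivity of the Choi matrix\<close>

lemma sum_lessThan_single:
  fixes f :: "nat \<Rightarrow> 'a::comm_monoid_add"
  assumes "i < n" "\<And>k. k \<noteq> i \<Longrightarrow> f k = 0"
  shows "(\<Sum>k<n. f k) = f i"
proof -
  have "(\<Sum>k<n. f k) = sum f {i}"
    using assms by (intro sum.mono_neutral_right) auto
  then show ?thesis by simp
qed

lemma pair_index_less:
  fixes a i N :: nat
  assumes "a < N" "i < N"
  shows "a * N + i < N * N"
proof -
  have "a * N + i < Suc a * N" using assms by simp
  also have "\<dots> \<le> N * N" using assms by (intro mult_le_mono1) simp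
  finally show ?thesis .
qed

lemma sum_lessThan_mult_pairs:
  fixes f :: "nat \<Rightarrow> 'a::comm_monoid_add"
  shows "(\<Sum>p<N * N. f p) = (\<Sum>a<N. \<Sum>i<N. f (a * N + i))"
proof -
  have "(\<Sum>a<N. \<Sum>i<N. f (a * N + i)) = (\<Sum>(a, i)\<in>{..<N} \<times> {..<N}. f (a * N + i))"
    by (simp add: sum.cartesian_product)
  also have "\<dots> = (\<Sum>p<N * N. f p)"
  proof (rule sum.reindex_bij_witness[of _ "\<lambda>p. (p div N, p mod N)" "\<lambda>(a, i). a * N + i"])
    fix p assume "p \<in> {..<N * N}"
    then have "p < N * N" by simp
    then show "(p div N, p mod N) \<in> {..<N} \<times> {..<N}"
      by (cases "N = 0") (auto simp: less_mult_imp_div_less)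
  next
    fix q assume "q \<in> {..<N} \<times> {..<N}"
    then show "(case q of (a, i) \<Rightarrow> a * N + i) \<in> {..<N * N}"
      by (auto simp: pair_index_less)
  qed auto
  finally show ?thesis ..
qed

lemma mult_mat_vec_cscalar_prod:
  assumes "A \<in> carrier_mat n n" "v \<in> carrier_vec n"
  shows "(A *\<^sub>v v) \<bullet>c v = (\<Sum>p<n. \<Sum>q<n. A $$ (p, q) * v $ q * cnj (v $ p))"
  using assms
  by (auto simp: scalar_prod_def sum_distrib_right atLeast0LessThan intro!: sum.cong)

text \<open>The quadratic form at \<open>v\<close> is the squared modulus of the inner product
  \<open>s\<close> of \<open>v\<close> with \<open>u\<close>.\<close>

lemma psd_mat_rank_one:
  fixes u :: "nat \<Rightarrow> complex"
  shows "psd_mat n (mat n n (\<lambda>(p, q). u p * cnj (u q)))"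
  unfolding psd_mat_def
proof (intro conjI ballI)
  fix v :: "complex vec" assume v: "v \<in> carrier_vec n"
  define s where "s = (\<Sum>q<n. cnj (u q) * v $ q)"
  have "(mat n n (\<lambda>(p, q). u p * cnj (u q)) *\<^sub>v v) \<bullet>c v =
      (\<Sum>p<n. \<Sum>q<n. u p * cnj (v $ p) * (cnj (u q) * v $ q))"
    by (subst mult_mat_vec_cscalar_prod[OF _ v]) (auto intro!: sum.cong)
  also have "\<dots> = cnj s * s"
    by (simp add: s_def sum_product)
  also have "0 \<le> \<dots>"
    by (simp add: mult.commute[of "cnj s"] complex_mult_cnj less_eq_complex_def)
  finally show "0 \<le> (mat n n (\<lambda>(p, q). u p * cnj (u q)) *\<^sub>v v) \<bullet>c v" .
qed simp

text \<open>
  The ampliation is applied to the unnormalised maximally entangled state, whose blocks are the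
  matrix units; the result is the Choi matrix.
\<close>

lemma completely_positive_choi:
  assumes "completely_positive N E"
  shows "0 \<le> (\<Sum>a<N. \<Sum>i<N. \<Sum>b<N. \<Sum>j<N. E (ketbra N a b) $$ (i, j) * w b j * cnj (w a i))"
proof -
  \<comment> \<open>An index \<open>p\<close> encodes the pair \<open>(p div N, p mod N)\<close>, so
    \<open>u\<close> is the sum of the vectors |aa>.\<close>
  define u :: "nat \<Rightarrow> complex" where "u = (\<lambda>p. if p div N = p mod N then 1 else 0)"
  define X where "X = mat (N * N) (N * N) (\<lambda>(p, q). u p * cnj (u q))"
  define v where "v = vec (N * N) (\<lambda>p. w (p div N) (p mod N))"
  have block: "mat_block N X a b = ketbra N a b" if "a < N" "b < N" for a b
    using that pair_index_less by (intro eq_matI) (auto simp: mat_block_def X_def u_def ketbra_def)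
  have "psd_mat (N * N) (ampliation N N E X)"
    using assms psd_mat_rank_one[of "N * N" u] by (auto simp: completely_positive_def X_def)
  then have "0 \<le> (ampliation N N E X *\<^sub>v v) \<bullet>c v"
    by (auto simp: psd_mat_def v_def)
  also have "\<dots> = (\<Sum>p<N * N. \<Sum>q<N * N. ampliation N N E X $$ (p, q) * v $ q * cnj (v $ p))"
    by (rule mult_mat_vec_cscalar_prod) (auto simp: ampliation_def v_def)
  also have "\<dots> = (\<Sum>a<N. \<Sum>i<N. \<Sum>b<N. \<Sum>j<N. E (ketbra N a b) $$ (i, j) * w b j * cnj (w a i))"
    unfolding sum_lessThan_mult_pairs
    by (intro sum.cong refl) (use pair_index_less block in \<open>auto simp: ampliation_def v_def\<close>)
  finally show ?thesis .
qed

section \<open>Positive semidefinite kernels and their factorisation\<close>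

text \<open>Keeping the matrix as a function of indices lets an induction on \<open>n\<close> drop
  the last index without changing carriers.\<close>

definition psd_kernel :: "nat \<Rightarrow> (nat \<Rightarrow> nat \<Rightarrow> complex) \<Rightarrow> bool" where
  "psd_kernel n M \<longleftrightarrow> (\<forall>c. 0 \<le> (\<Sum>i<n. \<Sum>j<n. M i j * c j * cnj (c i)))"

text \<open>Test vectors supported on \<open>i\<close> and \<open>j\<close> reduce the form to a 2x2
  principal submatrix.\<close>

lemma psd_kernel_pair:
  assumes M: "psd_kernel n M" and ij: "i < n" "j < n" "i \<noteq> j"
  shows "0 \<le> M i i * (x * cnj x) + M i j * y * cnj x + M j i * x * cnj y + M j j * (y * cnj y)"
proof -
  define c where "c = (\<lambda>k. if k = i then x else if k = j then y else 0)"
  have red: "(\<Sum>k<n. g k) = g i + g j" if "\<And>k. k \<noteq> i \<Longrightarrow> k \<noteq> j \<Longrightarrow> g k = 0" for g :: "nat \<Rightarrow> complex"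
  proof -
    have "(\<Sum>k<n. g k) = sum g {i, j}"
      using ij that by (intro sum.mono_neutral_right) auto
    then show ?thesis using ij by simp
  qed
  have "(\<Sum>k<n. \<Sum>l<n. M k l * c l * cnj (c k)) =
      M i i * x * cnj x + M i j * y * cnj x + (M j i * x * cnj y + M j j * y * cnj y)"
    by (subst red; (subst red)?) (use ij in \<open>auto simp: c_def red\<close>)
  moreover have "0 \<le> (\<Sum>k<n. \<Sum>l<n. M k l * c l * cnj (c k))"
    using M by (auto simp: psd_kernel_def)
  ultimately show ?thesis by (simp add: algebra_simps)
qed

lemma psd_kernel_diag:
  assumes M: "psd_kernel n M" and i: "i < n"
  shows "0 \<le> M i i"
proof -
  let ?c = "\<lambda>k. if k = i then 1 else 0"
  have "(\<Sum>k<n. \<Sum>l<n. M k l * ?c l * cnj (?c k)) = (\<Sum>l<n. M i l * ?c l * cnj (?c i))"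
    using i by (intro sum_lessThan_single) auto
  also have "\<dots> = M i i * ?c i * cnj (?c i)"
    using i by (intro sum_lessThan_single) auto
  finally show ?thesis
    using M[unfolded psd_kernel_def, rule_format, of ?c] by simp
qed

text \<open>Polarisation: the form is real at (1, 1) and at (1, \<open>\<i>\<close>). Since the
  diagonal is real, the first value fixes the imaginary parts and the second the real parts.\<close>

lemma psd_kernel_hermitian:
  assumes M: "psd_kernel n M" and ij: "i < n" "j < n"
  shows "M j i = cnj (M i j)"
proof (cases "i = j")
  case True
  then show ?thesis
    using psd_kernel_diag[OF M ij(1)] by (auto simp: less_eq_complex_def complex_eq_iff)
next
  case False
  note d = psd_kernel_diag[OF M ij(1)] psd_kernel_diag[OF M ij(2)]
  show ?thesis
    using psd_kernel_pair[OF M ij False, of 1 1] psd_kernel_pair[OF M ij False, of 1 \<i>] d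
    by (auto simp: less_eq_complex_def complex_eq_iff)
qed

text \<open>With a zero at \<open>(j, j)\<close> the form is affine along a suitable line of test
  vectors, and a nonconstant affine function takes negative values.\<close>

lemma psd_kernel_zero_diag:
  assumes M: "psd_kernel n M" and ij: "i < n" "j < n" and z: "M j j = 0"
  shows "M i j = 0"
proof (cases "i = j")
  case False
  define m where "m = M i j"
  define d where "d = Re (M i i)"
  have Mii: "M i i = complex_of_real d"
    using psd_kernel_diag[OF M ij(1)] by (auto simp: d_def less_eq_complex_def complex_eq_iff)
  have Mji: "M j i = cnj m"
    using psd_kernel_hermitian[OF M ij] by (simp add: m_def)
  have "0 \<le> d - 2 * t * (cmod m)\<^sup>2" for t :: real
    using psd_kernel_pair[OF M ij False, of 1 "- complex_of_real t * cnj m"] z Mji Mii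
    by (auto simp: less_eq_complex_def m_def[symmetric] cmod_power2 power2_eq_square[of "Re m"]
        power2_eq_square[of "Im m"] algebra_simps simp del: power2_eq_square)
  \<comment> \<open>For nonzero \<open>m\<close> this parameter gives the value -1.\<close>
  from this[of "(d + 1) / (2 * (cmod m)\<^sup>2)"] show ?thesis
    by (cases "m = 0") (auto simp: m_def)
qed (use z in simp)

text \<open>
  Cholesky factorisation: the last index is the pivot, and the Schur complement stays positive
  because the extra coordinate of the test vector can be chosen to minimise the form. For a zero
  pivot the whole last column vanishes, so the divisions by zero are harmless.
\<close>

lemma psd_kernel_factorization:
  assumes "psd_kernel n M"
  shows "\<exists>v. \<forall>i<n. \<forall>j<n. M i j = (\<Sum>k<n. v k i * cnj (v k j))"
  using assms
proof (induction n arbitrary: M)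
  case (Suc n)
  note M = Suc.prems
  define d where "d = Re (M n n)"
  have d0: "0 \<le> d" and Mnn: "M n n = complex_of_real d"
    using psd_kernel_diag[OF M, of n] by (auto simp: d_def less_eq_complex_def complex_eq_iff)
  have sd: "complex_of_real (sqrt d) * complex_of_real (sqrt d) = complex_of_real d"
    using d0 by (simp flip: of_real_mult)
  have herm: "M n i = cnj (M i n)" if "i < n" for i
    using psd_kernel_hermitian[OF M, of i n] that by simp
  have zero: "M i n = 0" if "i < n" "d = 0" for i
    using psd_kernel_zero_diag[OF M, of i n] that Mnn by simp
  define M' where "M' = (\<lambda>i j. M i j - M i n * cnj (M j n) / complex_of_real d)"
  have "psd_kernel n M'"
    unfolding psd_kernel_def
  proof
    fix c :: "nat \<Rightarrow> complex"
    define s where "s = (\<Sum>j<n. cnj (M j n) * c j)"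
    define t where "t = - s / complex_of_real d"
    define c' where "c' = c(n := t)"
    define q where "q = (\<Sum>i<n. \<Sum>j<n. M i j * c j * cnj (c i))"
    have cs: "cnj s = (\<Sum>i<n. M i n * cnj (c i))"
      by (simp add: s_def)
    have s0: "s = 0" if "d = 0"
      using that zero by (simp add: s_def)
    have "0 \<le> (\<Sum>i<Suc n. \<Sum>j<Suc n. M i j * c' j * cnj (c' i))"
      using M by (auto simp: psd_kernel_def)
    also have "\<dots> = q + (\<Sum>i<n. M i n * cnj (c i)) * t +
        ((\<Sum>j<n. cnj (M j n) * c j) * cnj t + M n n * t * cnj t)"
      by (simp add: c'_def q_def sum.distrib sum_distrib_right sum_distrib_left herm
          mult.commute mult.left_commute)
    \<comment> \<open>\<open>t\<close> is the minimiser found by completing the square; if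
      \<open>d = 0\<close>, then \<open>s\<close> vanishes and both sides are
      \<open>q\<close>.\<close>
    also have "\<dots> = q - s * cnj s / complex_of_real d"
      using s0 by (cases "d = 0") (simp_all add: Mnn t_def flip: cs s_def)
    also have "s * cnj s = (\<Sum>i<n. M i n * cnj (c i)) * (\<Sum>j<n. cnj (M j n) * c j)"
      by (simp add: s_def mult.commute)
    also have "\<dots> = (\<Sum>i<n. \<Sum>j<n. M i n * cnj (M j n) * c j * cnj (c i))"
      unfolding sum_product by (intro sum.cong refl) (simp add: mult_ac)
    also have "q - \<dots> / complex_of_real d = (\<Sum>i<n. \<Sum>j<n. M' i j * c j * cnj (c i))"
      by (simp add: q_def M'_def left_diff_distrib sum_subtractf sum_divide_distrib)
    finally show "0 \<le> (\<Sum>i<n. \<Sum>j<n. M' i j * c j * cnj (c i))" .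
  qed
  from Suc.IH[OF this] obtain v where
    v: "\<And>i j. i < n \<Longrightarrow> j < n \<Longrightarrow> M' i j = (\<Sum>k<n. v k i * cnj (v k j))" by blast
  \<comment> \<open>The factors of the Schur complement are extended by zero, and the new factor is
    the last column divided by the root of the pivot.\<close>
  define w where "w = (\<lambda>k i. if k < n then (if i < n then v k i else 0)
      else if i < n then M i n / complex_of_real (sqrt d) else complex_of_real (sqrt d))"
  have "M i j = (\<Sum>k<Suc n. w k i * cnj (w k j))" if ij: "i < Suc n" "j < Suc n" for i j
  proof -
    consider "i < n" "j < n" | "i < n" "j = n" | "i = n" "j < n" | "i = n" "j = n"
      using ij by linarith
    then show ?thesis
    proof cases
      case 1
      then show ?thesis using v[of i j] sd by (simp add: w_def M'_def diff_eq_eq)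
    next
      case 2
      then show ?thesis using zero[of i] by (cases "d = 0") (simp_all add: w_def)
    next
      case 3
      then show ?thesis using zero[of j] herm[of j] by (cases "d = 0") (simp_all add: w_def)
    next
      case 4
      then show ?thesis using sd Mnn by (simp add: w_def)
    qed
  qed
  then show ?case by blast
qed simp

section \<open>Kraus operators with at most one nonzero entry per row\<close>

text \<open>Describing an operator by a relabelling and coefficients makes conjugation by it an
  entrywise operation.\<close>

definition monomial_mat :: "nat \<Rightarrow> (nat \<Rightarrow> nat) \<Rightarrow> (nat \<Rightarrow> complex) \<Rightarrow> complex mat" where
  "monomial_mat N \<sigma> c = mat N N (\<lambda>(i, k). if k = \<sigma> i then c i else 0)"

lemma monomial_mat_carrier [simp]: "monomial_mat N \<sigma> c \<in> carrier_mat N N"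
  by (simp add: monomial_mat_def)

lemma mult3_index:
  fixes A B C :: "complex mat"
  assumes "A \<in> carrier_mat N N" "B \<in> carrier_mat N N" "C \<in> carrier_mat N N" "i < N" "j < N"
  shows "(A * B * C) $$ (i, j) = (\<Sum>l<N. \<Sum>k<N. A $$ (i, k) * B $$ (k, l) * C $$ (l, j))"
  using assms
  by (auto simp: scalar_prod_def sum_distrib_right atLeast0LessThan simp del: assoc_mult_mat
      intro!: sum.cong)

lemma monomial_conj_index:
  assumes \<sigma>: "\<And>i. i < N \<Longrightarrow> \<sigma> i < N" and \<rho>: "\<rho> \<in> carrier_mat N N" and ij: "i < N" "j < N"
  shows "(monomial_mat N \<sigma> c * \<rho> * mat_adjoint (monomial_mat N \<sigma> c)) $$ (i, j) =
    c i * cnj (c j) * \<rho> $$ (\<sigma> i, \<sigma> j)"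
proof -
  let ?K = "monomial_mat N \<sigma> c"
  have "(?K * \<rho> * mat_adjoint ?K) $$ (i, j) =
      (\<Sum>l<N. \<Sum>k<N. ?K $$ (i, k) * \<rho> $$ (k, l) * mat_adjoint ?K $$ (l, j))"
    using \<rho> ij by (intro mult3_index) (auto simp: monomial_mat_def)
  also have "\<dots> = (\<Sum>l<N. \<Sum>k<N. if k = \<sigma> i then (if l = \<sigma> j then c i * cnj (c j) * \<rho> $$ (k, l) else 0) else 0)"
    using ij by (intro sum.cong refl) (auto simp: monomial_mat_def)
  also have "\<dots> = c i * cnj (c j) * \<rho> $$ (\<sigma> i, \<sigma> j)"
    using \<sigma> ij by simp
  finally show ?thesis .
qed

text \<open>Injectivity makes every off-diagonal entry of the result a multiple of an off-diagonal
  entry of \<open>\<delta>\<close>.\<close>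

lemma monomial_conj_diagonal:
  assumes \<sigma>: "\<And>i. i < N \<Longrightarrow> \<sigma> i < N" "inj_on \<sigma> {..<N}"
    and \<delta>: "\<delta> \<in> carrier_mat N N" "diagonal_mat \<delta>"
  shows "diagonal_mat (monomial_mat N \<sigma> c * \<delta> * mat_adjoint (monomial_mat N \<sigma> c))"
  unfolding diagonal_mat_def
proof (intro allI impI)
  let ?K = "monomial_mat N \<sigma> c"
  fix i j assume "i < dim_row (?K * \<delta> * mat_adjoint ?K)" "j < dim_col (?K * \<delta> * mat_adjoint ?K)"
    and "i \<noteq> j"
  then have ij: "i < N" "j < N" "\<sigma> i \<noteq> \<sigma> j"
    using \<sigma>(2) by (auto simp: monomial_mat_def inj_on_def)
  then show "(?K * \<delta> * mat_adjoint ?K) $$ (i, j) = 0"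
    using \<sigma>(1) \<delta> by (subst monomial_conj_index) (auto simp: diagonal_mat_def)
qed

text \<open>Diagonality of \<open>\<delta>\<close> forces \<open>k = l\<close> in the double sum,
  and no row of the operator is nonzero in two distinct columns \<open>i\<close> and
  \<open>j\<close>.\<close>

lemma monomial_adjoint_conj_diagonal:
  assumes \<delta>: "\<delta> \<in> carrier_mat N N" "diagonal_mat \<delta>"
  shows "diagonal_mat (mat_adjoint (monomial_mat N \<sigma> c) * \<delta> * monomial_mat N \<sigma> c)"
  unfolding diagonal_mat_def
proof (intro allI impI)
  let ?K = "monomial_mat N \<sigma> c"
  fix i j assume "i < dim_row (mat_adjoint ?K * \<delta> * ?K)" "j < dim_col (mat_adjoint ?K * \<delta> * ?K)"
    and ne: "i \<noteq> j"
  then have ij: "i < N" "j < N" by (auto simp: monomial_mat_def)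
  then have "(mat_adjoint ?K * \<delta> * ?K) $$ (i, j) =
      (\<Sum>l<N. \<Sum>k<N. mat_adjoint ?K $$ (i, k) * \<delta> $$ (k, l) * ?K $$ (l, j))"
    using \<delta> by (intro mult3_index) (auto simp: monomial_mat_def)
  also have "\<dots> = 0"
    using \<delta> ij ne by (intro sum.neutral ballI) (auto simp: monomial_mat_def diagonal_mat_def)
  finally show "(mat_adjoint ?K * \<delta> * ?K) $$ (i, j) = 0" .
qed

text \<open>Reduces the existence of suitable Kraus operators to an entrywise formula, with an
  arbitrary finite index set that \<open>h\<close> enumerates.\<close>

lemma strictly_incoherent_operationI:
  assumes "cptp N E" and "finite I"
    and \<sigma>: "\<And>a i. a \<in> I \<Longrightarrow> i < N \<Longrightarrow> \<sigma> a i < N" "\<And>a. a \<in> I \<Longrightarrow> inj_on (\<sigma> a) {..<N}"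
    and carr: "\<And>\<rho>. \<rho> \<in> carrier_mat N N \<Longrightarrow> E \<rho> \<in> carrier_mat N N"
    and entry: "\<And>\<rho> i j. \<rho> \<in> carrier_mat N N \<Longrightarrow> i < N \<Longrightarrow> j < N \<Longrightarrow>
      E \<rho> $$ (i, j) = (\<Sum>a\<in>I. c a i * cnj (c a j) * \<rho> $$ (\<sigma> a i, \<sigma> a j))"
  shows "strictly_incoherent_operation N E"
proof -
  obtain h where h: "bij_betw h {0..<card I} I"
    using ex_bij_betw_nat_finite[OF \<open>finite I\<close>] by blast
  define K where "K = (\<lambda>a. monomial_mat N (\<sigma> (h a)) (c (h a)))"
  have hI: "h a \<in> I" if "a < card I" for a
    using h that by (auto simp: bij_betw_def)
  have "kraus_representation N E (card I) K"
    unfolding kraus_representation_def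
  proof (intro conjI ballI)
    show "\<forall>a<card I. K a \<in> carrier_mat N N" by (simp add: K_def)
    fix \<rho> :: "complex mat" assume \<rho>: "\<rho> \<in> carrier_mat N N"
    show "E \<rho> = msum N (\<lambda>a. K a * \<rho> * mat_adjoint (K a)) {..<card I}"
    proof (rule eq_matI)
      fix i j assume "i < dim_row (msum N (\<lambda>a. K a * \<rho> * mat_adjoint (K a)) {..<card I})"
        "j < dim_col (msum N (\<lambda>a. K a * \<rho> * mat_adjoint (K a)) {..<card I})"
      then have ij: "i < N" "j < N" by auto
      have "E \<rho> $$ (i, j) = (\<Sum>a\<in>I. c a i * cnj (c a j) * \<rho> $$ (\<sigma> a i, \<sigma> a j))"
        by (rule entry[OF \<rho> ij])
      also have "\<dots> = (\<Sum>a<card I. c (h a) i * cnj (c (h a) j) * \<rho> $$ (\<sigma> (h a) i, \<sigma> (h a) j))"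
        by (rule sum.reindex_bij_betw[symmetric]) (use h in \<open>simp add: atLeast0LessThan\<close>)
      also have "\<dots> = (\<Sum>a<card I. (K a * \<rho> * mat_adjoint (K a)) $$ (i, j))"
        unfolding K_def using \<sigma>(1) hI \<rho> ij by (intro sum.cong refl monomial_conj_index[symmetric]) auto
      finally show "E \<rho> $$ (i, j) = msum N (\<lambda>a. K a * \<rho> * mat_adjoint (K a)) {..<card I} $$ (i, j)"
        using ij by simp
    qed (use carr[OF \<rho>] in auto)
  qed
  moreover have "diagonal_mat (K a * \<delta> * mat_adjoint (K a)) \<and> diagonal_mat (mat_adjoint (K a) * \<delta> * K a)"
    if "a < card I" "\<delta> \<in> incoherent_states N" for a \<delta>
  proof -
    have \<delta>: "\<delta> \<in> carrier_mat N N" "diagonal_mat \<delta>"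
      using that by (auto simp: incoherent_states_def density_operators_def psd_mat_def)
    show ?thesis
      unfolding K_def using \<sigma> hI[OF that(1)] \<delta>
      by (intro conjI monomial_conj_diagonal monomial_adjoint_conj_diagonal) auto
  qed
  ultimately show ?thesis
    using assms(1) unfolding strictly_incoherent_operation_def by blast
qed

text \<open>For the Kraus sum: an operator attached to two distinct indices has nonzero entries only
  in those two rows, so row \<open>i\<close> sees only the pairs containing
  \<open>i\<close>.\<close>

lemma sum_pairs_at_index:
  fixes f :: "nat \<Rightarrow> nat \<Rightarrow> complex"
  assumes i: "i < N" and z: "\<And>\<mu> \<nu>. \<mu> \<noteq> \<nu> \<Longrightarrow> \<mu> \<noteq> i \<Longrightarrow> \<nu> \<noteq> i \<Longrightarrow> f \<mu> \<nu> = 0"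
  shows "(\<Sum>(\<mu>, \<nu>)\<in>{..<N} \<times> {..<N}. f \<mu> \<nu>) =
    (\<Sum>\<mu><N. f \<mu> \<mu>) + (\<Sum>\<nu>\<in>{..<N} - {i}. f i \<nu> + f \<nu> i)"
proof -
  have row: "(\<Sum>\<nu><N. f \<mu> \<nu>) = f \<mu> \<mu> + f \<mu> i" if "\<mu> \<in> {..<N} - {i}" for \<mu>
  proof -
    have "(\<Sum>\<nu><N. f \<mu> \<nu>) = (\<Sum>\<nu>\<in>{\<mu>, i}. f \<mu> \<nu>)"
      using that i z by (intro sum.mono_neutral_right) auto
    then show ?thesis using that by simp
  qed
  have "(\<Sum>(\<mu>, \<nu>)\<in>{..<N} \<times> {..<N}. f \<mu> \<nu>) = (\<Sum>\<mu><N. \<Sum>\<nu><N. f \<mu> \<nu>)"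
    by (simp add: sum.cartesian_product)
  also have "\<dots> = (\<Sum>\<nu><N. f i \<nu>) + (\<Sum>\<mu>\<in>{..<N} - {i}. f \<mu> \<mu> + f \<mu> i)"
    using i row by (subst sum.remove[of _ i]) (auto intro!: sum.cong)
  also have "(\<Sum>\<nu><N. f i \<nu>) = f i i + (\<Sum>\<nu>\<in>{..<N} - {i}. f i \<nu>)"
    using i by (subst sum.remove[of _ i]) auto
  moreover have "(\<Sum>\<mu><N. f \<mu> \<mu>) = f i i + (\<Sum>\<mu>\<in>{..<N} - {i}. f \<mu> \<mu>)"
    using i by (subst sum.remove[of _ i]) auto
  ultimately show ?thesis
    by (simp add: sum.distrib add_ac)
qed

section \<open>Positivity of the blocks of the Choi matrix\<close>

lemma ketbra_index: "i < N \<Longrightarrow> j < N \<Longrightarrow> ketbra N a b $$ (i, j) = (if i = a \<and> j = b then 1 else 0)"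
  by (simp add: ketbra_def)

lemma ketbra_carrier: "ketbra N a b \<in> carrier_mat N N"
  by (simp add: ketbra_def)

text \<open>Test vectors in the span of the |aa> isolate this block of the Choi matrix.\<close>

lemma aqnn_diag_kernel_psd:
  assumes "completely_positive N (aqnn_map N \<epsilon> \<gamma> \<alpha>)"
  shows "psd_kernel N (\<lambda>i j. if i = j then complex_of_real (1 - \<epsilon>)
    else if i < j then 1 + \<alpha> i j else cnj (1 + \<alpha> j i))" (is "psd_kernel N ?M")
  unfolding psd_kernel_def
proof
  fix c :: "nat \<Rightarrow> complex"
  let ?E = "aqnn_map N \<epsilon> \<gamma> \<alpha>"
  let ?w = "\<lambda>a i. if i = a then c a else 0"
  have "0 \<le> (\<Sum>a<N. \<Sum>i<N. \<Sum>b<N. \<Sum>j<N. ?E (ketbra N a b) $$ (i, j) * ?w b j * cnj (?w a i))"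
    by (rule completely_positive_choi[OF assms])
  also have "\<dots> = (\<Sum>a<N. \<Sum>b<N. \<Sum>j<N. ?E (ketbra N a b) $$ (a, j) * ?w b j * cnj (?w a a))"
    by (intro sum.cong refl sum_lessThan_single) auto
  also have "\<dots> = (\<Sum>a<N. \<Sum>b<N. ?E (ketbra N a b) $$ (a, b) * ?w b b * cnj (?w a a))"
    by (intro sum.cong refl sum_lessThan_single) auto
  also have "\<dots> = (\<Sum>a<N. \<Sum>b<N. ?E (ketbra N a b) $$ (a, b) * c b * cnj (c a))"
    by simp
  also have "\<dots> = (\<Sum>a<N. \<Sum>b<N. ?M a b * c b * cnj (c a))"
  proof (intro sum.cong refl, goal_cases)
    case (1 a b)
    then have "?E (ketbra N a b) $$ (a, b) = ?M a b"
      by (cases "a = b")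
         (simp_all add: aqnn_map_index_diag aqnn_map_index_offdiag ketbra_carrier ketbra_index)
    then show ?case by simp
  qed
  finally show "0 \<le> (\<Sum>a<N. \<Sum>b<N. ?M a b * c b * cnj (c a))" .
qed

text \<open>
  The form of the Choi matrix is evaluated on the span of the basis vectors \<open>|01\<rangle>\<close> and \<open>|10\<rangle>\<close>.
\<close>

lemma aqnn_norm_gamma_le:
  assumes "completely_positive N (aqnn_map N \<epsilon> \<gamma> \<alpha>)" and "2 \<le> N" and "0 \<le> \<epsilon>"
  shows "cmod \<gamma> \<le> \<epsilon> / (real N - 1)"
proof (cases "\<gamma> = 0")
  case True
  then show ?thesis using assms by simp
next
  case False
  let ?E = "aqnn_map N \<epsilon> \<gamma> \<alpha>"
  define p where "p = \<epsilon> / (real N - 1)"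
  \<comment> \<open>The phase that makes both cross terms equal to minus the modulus of
    \<open>\<gamma>\<close>, so the form becomes twice \<open>p - cmod \<gamma>\<close>. It has
    modulus one only for nonzero \<open>\<gamma>\<close>, hence the case split.\<close>
  define y where "y = - cnj (sgn \<gamma>)"
  have \<gamma>y: "\<gamma> * y = - complex_of_real (cmod \<gamma>)"
    using False by (simp add: y_def sgn_eq flip: complex_norm_square) (simp add: power2_eq_square)
  let ?w = "\<lambda>a i. if (a, i) = (0, 1) then 1 else if (a, i) = (1, 0) then y else 0"
  have red: "(\<Sum>k<N. g k) = g 0 + g 1" if "\<And>k. k \<noteq> 0 \<Longrightarrow> k \<noteq> 1 \<Longrightarrow> g k = 0" for g :: "nat \<Rightarrow> complex"
  proof -
    have "(\<Sum>k<N. g k) = sum g {0, 1}"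
      using assms(2) that by (intro sum.mono_neutral_right) auto
    then show ?thesis by simp
  qed
  have diag: "?E (ketbra N a a) $$ (i, i) = complex_of_real p" if "a < N" "i < N" "a \<noteq> i" for a i
  proof -
    have "(\<Sum>\<nu>\<in>{..<N} - {i}. complex_of_real p * ketbra N a a $$ (\<nu>, \<nu>)) =
        (\<Sum>\<nu>\<in>{..<N} - {i}. if \<nu> = a then complex_of_real p else 0)"
      by (intro sum.cong) (auto simp: ketbra_index)
    then show ?thesis using that unfolding p_def
      by (simp add: aqnn_map_index_diag ketbra_carrier ketbra_index)
  qed
  have "0 \<le> (\<Sum>a<N. \<Sum>i<N. \<Sum>b<N. \<Sum>j<N. ?E (ketbra N a b) $$ (i, j) * ?w b j * cnj (?w a i))"
    by (rule completely_positive_choi[OF assms(1)])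
  also have "\<dots> = ?E (ketbra N 0 0) $$ (1, 1) + ?E (ketbra N 0 1) $$ (1, 0) * y +
      (?E (ketbra N 1 0) $$ (0, 1) * cnj y + ?E (ketbra N 1 1) $$ (0, 0) * y * cnj y)"
  proof -
    have inner: "(\<Sum>b<N. \<Sum>j<N. F b j * ?w b j * z) = F 0 1 * z + F 1 0 * y * z"
      for F :: "nat \<Rightarrow> nat \<Rightarrow> complex" and z
      by (subst red; (subst red)?) (auto simp: red)
    show ?thesis
      unfolding inner by (subst red; (subst red)?) (auto simp: red)
  qed
  also have "\<dots> = complex_of_real p + \<gamma> * y + (cnj \<gamma> * cnj y + complex_of_real p * (y * cnj y))"
    using assms(2) by (simp add: diag aqnn_map_index_offdiag ketbra_carrier ketbra_index)
  also have "\<gamma> * y = - complex_of_real (cmod \<gamma>)"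
    by (rule \<gamma>y)
  also have "cnj \<gamma> * cnj y = - complex_of_real (cmod \<gamma>)"
    using arg_cong[OF \<gamma>y, of cnj] by simp
  also have "y * cnj y = 1"
    using False by (simp add: y_def mult.commute[of _ "sgn \<gamma>"] norm_sgn flip: complex_norm_square)
  finally show ?thesis by (simp add: less_eq_complex_def p_def)
qed

section \<open>Explicit Kraus operators for the map\<close>

theorem lemma8:
  fixes N :: nat and \<epsilon> :: real and \<gamma> :: complex and \<alpha> :: "nat \<Rightarrow> nat \<Rightarrow> complex"
  assumes "2 \<le> N"
    and "0 \<le> \<epsilon>" and "\<epsilon> \<le> 1"
    and "cptp N (aqnn_map N \<epsilon> \<gamma> \<alpha>)"
  shows "strictly_incoherent_operation N (aqnn_map N \<epsilon> \<gamma> \<alpha>)"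
proof -
  let ?E = "aqnn_map N \<epsilon> \<gamma> \<alpha>"
  have cp: "completely_positive N ?E" using assms by (simp add: cptp_def)
  define M where "M = (\<lambda>i j. if i = j then complex_of_real (1 - \<epsilon>)
    else if i < j then 1 + \<alpha> i j else cnj (1 + \<alpha> j i))"
  obtain v where v: "\<And>i j. i < N \<Longrightarrow> j < N \<Longrightarrow> M i j = (\<Sum>k<N. v k i * cnj (v k j))"
    using psd_kernel_factorization[OF aqnn_diag_kernel_psd[OF cp]] unfolding M_def by blast
  define p where "p = \<epsilon> / (real N - 1)"
  have \<gamma>p: "cmod \<gamma> \<le> p" using aqnn_norm_gamma_le[OF cp assms(1,2)] by (simp add: p_def)
  then have p0: "0 \<le> p" using norm_ge_zero[of \<gamma>] by linarith
  define x y z where "x = \<gamma> / complex_of_real (sqrt p)" and "y = complex_of_real (sqrt p)"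
    and "z = complex_of_real (sqrt (p - (cmod \<gamma>)\<^sup>2 / p))"
  have yy: "y * cnj y = complex_of_real p"
    using p0 by (simp add: y_def flip: of_real_mult)
  have xy: "x * cnj y = \<gamma>"
    using \<gamma>p by (cases "p = 0") (auto simp: x_def y_def)
  have yx: "y * cnj x = cnj \<gamma>"
    using arg_cong[OF xy, of cnj] by (simp add: mult.commute)
  \<comment> \<open>The 2x2 block has nonnegative determinant; this makes the radicand in
    \<open>z\<close> nonnegative.\<close>
  have "(cmod \<gamma>)\<^sup>2 \<le> p * p"
    using power_mono[OF \<gamma>p, of 2] by (simp add: power2_eq_square)
  then have "(cmod \<gamma>)\<^sup>2 / p \<le> p"
    using p0 by (cases "p = 0") (auto simp: field_simps)
  then have zz: "z * cnj z = complex_of_real (p - (cmod \<gamma>)\<^sup>2 / p)"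
    by (simp add: z_def flip: of_real_mult)
  have "x * cnj x = complex_of_real ((cmod \<gamma>)\<^sup>2 / p)"
    using p0 by (simp add: x_def flip: of_real_mult complex_norm_square)
  then have xz: "x * cnj x + z * cnj z = complex_of_real p"
    using zz by simp
  \<comment> \<open>The \<open>2 \<times> 2\<close> block is the sum of the rank-one matrices of \<open>(x, y)\<close> and \<open>(z, 0)\<close>. With
    \<open>transpose \<mu> \<mu> = id\<close>, the pair \<open>(\<mu>, \<mu>)\<close> indexes a diagonal Kraus operator, \<open>\<mu> < \<nu>\<close> the first
    rank-one term and \<open>\<mu> > \<nu>\<close> the second. For \<open>p = 0\<close> also \<open>\<gamma> = 0\<close>, and the junk value \<open>0 / 0 = 0\<close>
    is the right one.\<close>
  define c where "c = (\<lambda>\<mu> \<nu> i. if \<mu> = \<nu> then v \<mu> i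
    else if \<mu> < \<nu> then (if i = \<nu> then x else if i = \<mu> then y else 0)
    else if i = \<mu> then z else 0)"
  show ?thesis
  proof (rule strictly_incoherent_operationI[where I = "{..<N} \<times> {..<N}"
        and c = "\<lambda>(\<mu>, \<nu>). c \<mu> \<nu>" and \<sigma> = "\<lambda>(\<mu>, \<nu>). transpose \<mu> \<nu>"])
    fix \<rho> :: "complex mat" and i j assume \<rho>: "\<rho> \<in> carrier_mat N N" and ij: "i < N" "j < N"
    define f where "f = (\<lambda>\<mu> \<nu>. c \<mu> \<nu> i * cnj (c \<mu> \<nu> j) * \<rho> $$ (transpose \<mu> \<nu> i, transpose \<mu> \<nu> j))"
    have "(\<Sum>(\<mu>, \<nu>)\<in>{..<N} \<times> {..<N}. f \<mu> \<nu>) =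
        (\<Sum>\<mu><N. f \<mu> \<mu>) + (\<Sum>\<nu>\<in>{..<N} - {i}. f i \<nu> + f \<nu> i)"
      using ij(1) by (intro sum_pairs_at_index) (auto simp: f_def c_def)
    also have "(\<Sum>\<mu><N. f \<mu> \<mu>) = M i j * \<rho> $$ (i, j)"
      using v[OF ij] by (simp add: f_def c_def sum_distrib_right)
    also have "M i j * \<rho> $$ (i, j) + (\<Sum>\<nu>\<in>{..<N} - {i}. f i \<nu> + f \<nu> i) = ?E \<rho> $$ (i, j)"
    proof (cases "i = j")
      case True
      \<comment> \<open>As the larger index of the pair, \<open>i\<close> carries \<open>x\<close>
        and \<open>z\<close> from the two rank-one terms; as the smaller one it carries only
        \<open>y\<close>. Either way the weights add up to \<open>p\<close>.\<close>
      have "f i \<nu> + f \<nu> i = complex_of_real p * \<rho> $$ (\<nu>, \<nu>)" if "\<nu> \<noteq> i" for \<nu>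
      proof (cases "\<nu> < i")
        case True
        then have "f i \<nu> + f \<nu> i = (x * cnj x + z * cnj z) * \<rho> $$ (\<nu>, \<nu>)"
          using \<open>i = j\<close> by (simp add: f_def c_def algebra_simps)
        then show ?thesis by (simp only: xz)
      next
        case False
        then show ?thesis using \<open>i = j\<close> that by (simp add: f_def c_def yy)
      qed
      then show ?thesis
        using ij \<rho> True by (simp add: aqnn_map_index_diag M_def p_def)
    next
      case False
      \<comment> \<open>Both rows must belong to the pair. The term of \<open>(z, 0)\<close> lives
        in a single row and drops out, while the transposition in the other one produces the swapped
        entry of \<open>\<rho>\<close>.\<close>
      have "(\<Sum>\<nu>\<in>{..<N} - {i}. f i \<nu> + f \<nu> i) = (\<Sum>\<nu>\<in>{j}. f i \<nu> + f \<nu> i)"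
        using False ij by (intro sum.mono_neutral_right) (auto simp: f_def c_def)
      also have "\<dots> = (if i < j then cnj \<gamma> else \<gamma>) * \<rho> $$ (j, i)"
        using False by (auto simp: f_def c_def xy yx)
      finally show ?thesis
        using ij \<rho> False by (simp add: aqnn_map_index_offdiag M_def)
    qed
    finally show "?E \<rho> $$ (i, j) = (\<Sum>a\<in>{..<N} \<times> {..<N}. (case a of (\<mu>, \<nu>) \<Rightarrow> c \<mu> \<nu>) i *
        cnj ((case a of (\<mu>, \<nu>) \<Rightarrow> c \<mu> \<nu>) j) *
        \<rho> $$ ((case a of (\<mu>, \<nu>) \<Rightarrow> transpose \<mu> \<nu>) i, (case a of (\<mu>, \<nu>) \<Rightarrow> transpose \<mu> \<nu>) j))"
      by (simp add: f_def case_prod_beta)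
  next
    fix a i assume "a \<in> {..<N} \<times> {..<N}" "i < N"
    then show "(case a of (\<mu>, \<nu>) \<Rightarrow> transpose \<mu> \<nu>) i < N"
      by (auto simp: transpose_def)
  next
    fix a assume "a \<in> {..<N} \<times> {..<N}"
    show "inj_on (case a of (\<mu>, \<nu>) \<Rightarrow> transpose \<mu> \<nu>) {..<N}"
      by (cases a) (auto intro: inj_on_subset[OF inj_transpose])
  qed (use assms aqnn_map_carrier in auto)
qed

end
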